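(* Let $k$ be a field, $<$ a monomial preorder on $k[X]=k[x_1,\dots,x_n]$, and let $<^*$ be the product of $<$ with a global monomial order. Let $I$ be an ideal in $k[X]_<$ (which equals $k[X]_{<^*}$). Then every standard basis $G$ of $I$ with respect to $<^*$ is also a standard basis of $I$ with respect to $<$.
   Context: For $a\in\mathbb{N}^n$ write $x^a=x_1^{\alpha_1}\cdots x_n^{\alpha_n}$. A weak order on a set is a strict partial order for which incomparability is an equivalence relation. A monomial preorder on $k[X]$ is a weak order $<$ on the monomials such that for all $a,b,c\in\mathbb{N}^n$: $x^a<x^b$ if and only if $x^ax^c<x^bx^c$. A monomial order is a monomial preorder that is a total order. A monomial preorder is global if for each $i$ either $1<x_i$ or $1$ and $x_i$ are incomparable. The product $<^*$ of $<$ with $<'$ is the monomial preorder with $x^a<^*x^b$ iff $x^a<x^b$, or $x^a,x^b$ are incomparable with respect to $<$ and $x^a<'x^b$. For $f=\sum c_ax^a\in k[X]$, the leading part $L_<(f)$ is the sum of those terms $c_ax^a$ ($c_a\ne0$) such that no monomial $x^b$ occurring in $f$ satisfies $x^a<x^b$. Put $S_<=\{u\in k[X]\mid L_<(u)=1\}$ (a multiplicative set) and $k[X]_<=S_<^{-1}k[X]$. For $f\in k[X]_<$ choose $u\in S_<$ with $uf\in k[X]$ and set $L_<(f)=L_<(uf)$ (independent of $u$). For a subset $G\subseteq k[X]_<$, the leading ideal $L_<(G)$ is the ideal of $k[X]$ generated by all $L_<(f)$, $f\in G$. A standard basis of an ideal $I\subseteq k[X]_<$ with respect to $<$ is a finite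 set $G$ of elements of $I$ with $L_<(G)=L_<(I)$. *)

theory Defs
  imports
    "HOL-Library.Poly_Mapping"
    "HOL-Computational_Algebra.Fraction_Field"
    "HOL-Algebra.Ideal"
    "HOL-Algebra.Algebraic_Closure_Type"
begin

text \<open>
  The variables are indexed by a type \<open>'n\<close> of sort \<open>{finite, linorder}\<close>; a monomial is represented
  by its exponent vector.  The linear order on \<open>'n\<close> is there only so that the library
  provides the \<open>idom\<close> instance for \<open>('n, 'k) mpoly\<close> on which \<open>fract\<close> depends.  It is unrelated
  to the monomial preorders, which are passed as explicit relations.
\<close>

type_synonym 'n monomial = "'n \<Rightarrow>\<^sub>0 nat"
type_synonym ('n, 'k) mpoly = "('n \<Rightarrow>\<^sub>0 nat) \<Rightarrow>\<^sub>0 'k"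

definition incomparable :: "('a \<Rightarrow> 'a \<Rightarrow> bool) \<Rightarrow> 'a \<Rightarrow> 'a \<Rightarrow> bool" where
  "incomparable lt x y \<longleftrightarrow> \<not> lt x y \<and> \<not> lt y x"

definition weak_order :: "('a \<Rightarrow> 'a \<Rightarrow> bool) \<Rightarrow> bool" where
  "weak_order lt \<longleftrightarrow> irreflp lt \<and> transp lt \<and> equivp (incomparable lt)"

definition monomial_preorder :: "('n monomial \<Rightarrow> 'n monomial \<Rightarrow> bool) \<Rightarrow> bool" where
  "monomial_preorder lt \<longleftrightarrow>
     weak_order lt \<and> (\<forall>a b c. lt a b \<longleftrightarrow> lt (a + c) (b + c))"

definition monomial_order :: "('n monomial \<Rightarrow> 'n monomial \<Rightarrow> bool) \<Rightarrow> bool" where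
  "monomial_order lt \<longleftrightarrow> monomial_preorder lt \<and> totalp lt"

definition global_preorder :: "('n monomial \<Rightarrow> 'n monomial \<Rightarrow> bool) \<Rightarrow> bool" where
  "global_preorder lt \<longleftrightarrow>
     (\<forall>i. lt 0 (Poly_Mapping.single i 1) \<or> incomparable lt 0 (Poly_Mapping.single i 1))"

definition product_preorder ::
    "('a \<Rightarrow> 'a \<Rightarrow> bool) \<Rightarrow> ('a \<Rightarrow> 'a \<Rightarrow> bool) \<Rightarrow> 'a \<Rightarrow> 'a \<Rightarrow> bool" where
  "product_preorder lt lt' a b \<longleftrightarrow> lt a b \<or> (incomparable lt a b \<and> lt' a b)"

definition leading_part ::
    "('n monomial \<Rightarrow> 'n monomial \<Rightarrow> bool) \<Rightarrow> ('n, 'k::field) mpoly \<Rightarrow> ('n, 'k) mpoly" where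
  "leading_part lt f =
     (\<Sum>a \<in> {a \<in> Poly_Mapping.keys f. \<not> (\<exists>b \<in> Poly_Mapping.keys f. lt a b)}. Poly_Mapping.single a (Poly_Mapping.lookup f a))"

definition unit_leading ::
    "('n monomial \<Rightarrow> 'n monomial \<Rightarrow> bool) \<Rightarrow> ('n, 'k::field) mpoly set" where
  "unit_leading lt = {u. leading_part lt u = 1}"

text \<open>
  As \<open>k[X]\<close> is a domain and \<open>0 \<notin> unit_leading lt\<close>, the localization of \<open>k[X]\<close> at the multiplicative
  set \<open>unit_leading lt\<close> is realized as a subring of the field of fractions.
\<close>

definition localization ::
    "('n monomial \<Rightarrow> 'n monomial \<Rightarrow> bool) \<Rightarrow>
       ('n::{finite,linorder}, 'k::field) mpoly fract set" where
  "localization lt = {Fract g u | g u. u \<in> unit_leading lt}"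

definition localization_ring ::
    "('n monomial \<Rightarrow> 'n monomial \<Rightarrow> bool) \<Rightarrow>
       ('n::{finite,linorder}, 'k::field) mpoly fract ring" where
  "localization_ring lt = ring_of_type_algebra\<lparr>carrier := localization lt\<rparr>"

text \<open>
  The leading part on the localization does not depend on the choice of the denominator \<open>u\<close>.  It is
  meaningful only for \<open>f \<in> localization lt\<close>.
\<close>

definition loc_leading_part ::
    "('n monomial \<Rightarrow> 'n monomial \<Rightarrow> bool) \<Rightarrow>
       ('n::{finite,linorder}, 'k::field) mpoly fract \<Rightarrow> ('n, 'k) mpoly" where
  "loc_leading_part lt f =
     leading_part lt (SOME g. \<exists>u \<in> unit_leading lt. Fract u 1 * f = Fract g 1)"

definition leading_ideal ::
    "('n monomial \<Rightarrow> 'n monomial \<Rightarrow> bool) \<Rightarrow>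
       ('n::{finite,linorder}, 'k::field) mpoly fract set \<Rightarrow> ('n, 'k) mpoly set" where
  "leading_ideal lt G = genideal ring_of_type_algebra (loc_leading_part lt ` G)"

definition standard_basis ::
    "('n monomial \<Rightarrow> 'n monomial \<Rightarrow> bool) \<Rightarrow>
       ('n::{finite,linorder}, 'k::field) mpoly fract set \<Rightarrow>
       ('n, 'k) mpoly fract set \<Rightarrow> bool" where
  "standard_basis lt I G \<longleftrightarrow> finite G \<and> G \<subseteq> I \<and> leading_ideal lt G = leading_ideal lt I"

end

theory Submission
  imports Defs
begin

text \<open>
  Since \<open>lt'\<close> is global, no monomial lies below \<open>1\<close> for \<open>lt'\<close>, so \<open>lt\<close> and the product order have the
  same units and hence the same localization.  Let \<open>p\<close> be a polynomial in \<open>I\<close> whose leading monomial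
  for the product order is \<open>m\<close>.  As leading ideals for a total order are generated by monomials,
  some \<open>g \<in> G\<close>, cleared of its denominator to a polynomial \<open>q\<close>, has a leading monomial dividing
  \<open>m\<close>.  Subtracting the matching monomial multiple \<open>t * q\<close> cancels \<open>m\<close>, and either the \<open>lt\<close>-leading
  part of \<open>p\<close> equals \<open>t\<close> times that of \<open>q\<close>, or the difference of the two is the \<open>lt\<close>-leading part of
  \<open>p - t * q\<close>, whose leading monomial is in the same \<open>lt\<close>-class as \<open>m\<close> but smaller for \<open>lt'\<close>.  By
  Dickson's lemma \<open>lt'\<close> is well-founded, so this division process ends.
\<close>

section \<open>Dickson's lemma for exponent vectors\<close>

text \<open>A monotone subsequence always exists; if it decreases, it is constant from the index of
  its minimum on, and that tail serves.\<close>

lemma incseq_subseq_nat: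
  fixes s :: "nat \<Rightarrow> nat"
  shows "\<exists>\<phi>. strict_mono \<phi> \<and> incseq (\<lambda>k. s (\<phi> k))"
proof -
  obtain \<phi> where \<phi>: "strict_mono \<phi>" "monoseq (\<lambda>k. s (\<phi> k))"
    using seq_monosub by blast
  consider "incseq (\<lambda>k. s (\<phi> k))" | "decseq (\<lambda>k. s (\<phi> k))"
    using \<phi>(2) by (auto simp: monoseq_iff)
  then show ?thesis
  proof cases
    case 1
    then show ?thesis using \<phi>(1) by blast
  next
    case 2
    obtain N where N: "\<And>k. s (\<phi> N) \<le> s (\<phi> k)"
      using ex_has_least_nat[of "\<lambda>_. True" undefined "\<lambda>k. s (\<phi> k)"] by auto
    have "s (\<phi> (N + k)) = s (\<phi> N)" for k
      using N[of "N + k"] decseqD[OF 2, of N "N + k"] by simp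
    moreover have "strict_mono (\<lambda>k. \<phi> (N + k))"
      using \<phi>(1) by (simp add: strict_mono_def)
    ultimately show ?thesis
      by (intro exI[of _ "\<lambda>k. \<phi> (N + k)"]) (simp add: incseq_def)
  qed
qed

text \<open>The sequence is thinned out one coordinate at a time; a further subsequence keeps the
  coordinates already treated increasing.\<close>

lemma incseq_subseq_finite:
  fixes s :: "nat \<Rightarrow> 'i \<Rightarrow> nat"
  assumes "finite A"
  shows "\<exists>\<phi>. strict_mono \<phi> \<and> (\<forall>i\<in>A. incseq (\<lambda>k. s (\<phi> k) i))"
  using assms
proof (induction A rule: finite_induct)
  case empty
  then show ?case by (auto intro: strict_mono_id[unfolded id_def])
next
  case (insert x A)
  then obtain \<phi> where \<phi>: "strict_mono \<phi>" "\<forall>i\<in>A. incseq (\<lambda>k. s (\<phi> k) i)" by blast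
  obtain \<psi> where \<psi>: "strict_mono \<psi>" "incseq (\<lambda>k. s (\<phi> (\<psi> k)) x)"
    using incseq_subseq_nat[of "\<lambda>k. s (\<phi> k) x"] by auto
  have "incseq (\<lambda>k. s (\<phi> (\<psi> k)) i)" if "i \<in> A" for i
    using \<phi>(2) that \<psi>(1) by (simp add: incseq_def strict_mono_less_eq)
  with \<phi>(1) \<psi> show ?case
    by (intro exI[of _ "\<lambda>k. \<phi> (\<psi> k)"]) (auto simp: strict_mono_def)
qed

text \<open>Along a common increasing subsequence the first term is coordinatewise at most the
  second, so truncated subtraction of exponents gives the quotient \<open>c\<close>.\<close>

lemma dickson:
  fixes s :: "nat \<Rightarrow> 'n::finite monomial"
  shows "\<exists>i j c. i < j \<and> s j = s i + c"
proof -
  obtain \<phi> where \<phi>: "strict_mono \<phi>"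
    "\<forall>i\<in>(UNIV :: 'n set). incseq (\<lambda>k. Poly_Mapping.lookup (s (\<phi> k)) i)"
    using incseq_subseq_finite[of "UNIV :: 'n set" "\<lambda>k. Poly_Mapping.lookup (s k)"] by auto
  have "Poly_Mapping.lookup (s (\<phi> 0)) i \<le> Poly_Mapping.lookup (s (\<phi> 1)) i" for i
    using \<phi>(2) by (simp add: incseq_def)
  then have "s (\<phi> 1) = s (\<phi> 0) + (s (\<phi> 1) - s (\<phi> 0))"
    by (intro poly_mapping_eqI) (simp add: lookup_add lookup_minus)
  moreover have "\<phi> 0 < \<phi> 1" using \<phi>(1) by (simp add: strict_mono_def)
  ultimately show ?thesis by blast
qed

section \<open>Strict comparison and incomparability for monomial preorders\<close>

lemma monomial_preorder_irrefl: "monomial_preorder lt \<Longrightarrow> \<not> lt a a"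
  by (simp add: monomial_preorder_def weak_order_def irreflpD)

lemma monomial_preorder_trans: "monomial_preorder lt \<Longrightarrow> lt a b \<Longrightarrow> lt b c \<Longrightarrow> lt a c"
  by (meson monomial_preorder_def weak_order_def transpD)

lemma monomial_preorder_add_iff: "monomial_preorder lt \<Longrightarrow> lt (a + c) (b + c) \<longleftrightarrow> lt a b"
  by (simp add: monomial_preorder_def)

lemma monomial_preorder_add_iff_left: "monomial_preorder lt \<Longrightarrow> lt (c + a) (c + b) \<longleftrightarrow> lt a b"
  by (metis monomial_preorder_add_iff add.commute)

lemma incomparable_sym: "incomparable lt a b \<Longrightarrow> incomparable lt b a"
  by (auto simp: incomparable_def)

lemma incomparable_trans:
  "monomial_preorder lt \<Longrightarrow> incomparable lt a b \<Longrightarrow> incomparable lt b c \<Longrightarrow> incomparable lt a c"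
  by (meson monomial_preorder_def weak_order_def equivp_transp)

text \<open>If \<open>a\<close> and \<open>c\<close> were incomparable, so would be \<open>a\<close>
  and \<open>b\<close>; and \<open>lt c a\<close> would give \<open>lt c b\<close>.\<close>

lemma less_incomparable_trans:
  assumes "monomial_preorder lt" "lt a b" "incomparable lt b c"
  shows "lt a c"
  by (metis assms incomparable_def incomparable_trans incomparable_sym monomial_preorder_trans)

lemma incomparable_less_trans:
  assumes "monomial_preorder lt" "incomparable lt a b" "lt b c"
  shows "lt a c"
  by (metis assms incomparable_def incomparable_trans incomparable_sym monomial_preorder_trans)

lemma incomparable_add_iff_left:
  "monomial_preorder lt \<Longrightarrow> incomparable lt (c + a) (c + b) \<longleftrightarrow> incomparable lt a b"
  by (simp add: incomparable_def monomial_preorder_add_iff_left)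

section \<open>Positivity and well-foundedness of global monomial orders\<close>

text \<open>Totality forces every variable above \<open>1\<close>, and every monomial is a product
  of powers of variables, so \<open>1\<close> is the least monomial.\<close>

lemma global_monomial_order_nonneg:
  assumes lt: "monomial_order lt" and gl: "global_preorder lt"
  shows "\<not> lt a 0"
proof -
  have mp: "monomial_preorder lt" and tot: "totalp lt"
    using lt by (auto simp: monomial_order_def)
  have pos: "lt 0 (Poly_Mapping.single i 1)" for i
    using gl tot by (metis global_preorder_def incomparable_def single_zero inj_single
        injD totalpD zero_neq_one)
  have pos_add: "a + b = 0 \<or> lt 0 (a + b)" if "a = 0 \<or> lt 0 a" "b = 0 \<or> lt 0 b" for a b
    using that monomial_preorder_add_iff_left[OF mp, of a 0 b] monomial_preorder_trans[OF mp]
    by (metis add.right_neutral add.left_neutral)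
  have pos_single: "Poly_Mapping.single i n = 0 \<or> lt 0 (Poly_Mapping.single i n)" for i n
  proof (induction n)
    case (Suc n)
    have "Poly_Mapping.single i (Suc n) = Poly_Mapping.single i n + Poly_Mapping.single i 1"
      by (simp flip: single_add)
    then show ?case using pos_add[OF Suc] pos[of i] by metis
  qed simp
  \<comment> \<open>The induction fills in one fresh coordinate at a time, where an update is the
    addition of a \<open>single\<close>.\<close>
  have pos': "a = 0 \<or> lt 0 a" for a
  proof (induction a rule: update_induct)
    case (update a k n)
    have "Poly_Mapping.update k n a = a + Poly_Mapping.single k n"
      using update(1) by (intro poly_mapping_eqI)
        (auto simp: lookup_update lookup_add lookup_single when_def in_keys_iff)
    then show ?case using pos_add[OF update(3) pos_single] by metis
  qed simp
  show ?thesis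
    using pos'[of a] monomial_preorder_irrefl[OF mp] monomial_preorder_trans[OF mp] by blast
qed

text \<open>In an infinite descending chain Dickson's lemma finds a multiple \<open>s i + c\<close>
  below \<open>s i\<close>; cancelling \<open>s i\<close> puts \<open>c\<close> below
  \<open>1\<close>.\<close>

lemma global_monomial_order_wfp:
  fixes lt :: "'n::finite monomial \<Rightarrow> 'n monomial \<Rightarrow> bool"
  assumes lt: "monomial_order lt" and gl: "global_preorder lt"
  shows "wfp lt"
proof -
  have mp: "monomial_preorder lt"
    using lt by (auto simp: monomial_order_def)
  have False if desc: "\<And>i. lt (s (Suc i)) (s i)" for s
  proof -
    have "lt (s j) (s i)" if "i < j" for i j
      using that
      by (induction j) (metis desc less_Suc_eq monomial_preorder_trans[OF mp] not_less_zero)+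
    moreover obtain i j c where "i < j" "s j = s i + c"
      using dickson by blast
    \<comment> \<open>The summand \<open>0\<close> prepares the left cancellation that leaves
      \<open>lt c 0\<close>.\<close>
    ultimately have "lt (s i + c) (s i + 0)" by (metis add.right_neutral)
    then show False
      using global_monomial_order_nonneg[OF lt gl] by (simp only: monomial_preorder_add_iff_left[OF mp])
  qed
  then show ?thesis
    by (auto simp: wfp_def wf_iff_no_infinite_down_chain)
qed

section \<open>The product of a preorder with a monomial order\<close>

text \<open>Ties under \<open>lt\<close> are broken by the total \<open>lt'\<close>, so the product
  order is total.\<close>

lemma product_incomparable_iff:
  assumes "monomial_preorder lt" "monomial_order lt'"
  shows "incomparable (product_preorder lt lt') a b \<longleftrightarrow> a = b"
proof -
  have "\<not> lt a a" "\<not> lt' a a" for a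
    using assms by (auto simp: monomial_order_def monomial_preorder_irrefl)
  moreover have "a = b \<or> lt' a b \<or> lt' b a"
    using assms(2) totalpD unfolding monomial_order_def by metis
  ultimately show ?thesis
    by (auto simp: incomparable_def product_preorder_def)
qed

text \<open>In the mixed cases of transitivity, \<open>lt\<close> absorbs an incomparability on
  either side. Incomparability for the product is equality, hence an equivalence.\<close>

lemma monomial_preorder_product:
  assumes lt: "monomial_preorder lt" and lt': "monomial_order lt'"
  shows "monomial_preorder (product_preorder lt lt')"
proof -
  have mp': "monomial_preorder lt'" using lt' by (simp add: monomial_order_def)
  have "transp (product_preorder lt lt')"
  proof (rule transpI)
    fix a b c
    assume "product_preorder lt lt' a b" "product_preorder lt lt' b c"
    then show "product_preorder lt lt' a c"
      unfolding product_preorder_def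
      using monomial_preorder_trans[OF lt] monomial_preorder_trans[OF mp']
        less_incomparable_trans[OF lt] incomparable_less_trans[OF lt] incomparable_trans[OF lt]
      by blast
  qed
  moreover have "irreflp (product_preorder lt lt')"
    using monomial_preorder_irrefl[OF lt] monomial_preorder_irrefl[OF mp']
    by (auto intro!: irreflpI simp: product_preorder_def)
  moreover have "incomparable (product_preorder lt lt') = (=)"
    using product_incomparable_iff[OF lt lt'] by blast
  ultimately show ?thesis
    using lt mp' by (simp add: monomial_preorder_def weak_order_def identity_equivp
        product_preorder_def incomparable_def)
qed

section \<open>Leading parts of polynomials\<close>

lemma lookup_leading_part:
  "Poly_Mapping.lookup (leading_part lt f) a =
    (if \<exists>b\<in>Poly_Mapping.keys f. lt a b then 0 else Poly_Mapping.lookup f a)"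
proof -
  have "Poly_Mapping.lookup (leading_part lt f) a =
      (\<Sum>x \<in> {a \<in> Poly_Mapping.keys f. \<not> (\<exists>b\<in>Poly_Mapping.keys f. lt a b)}.
        if x = a then Poly_Mapping.lookup f a else 0)"
    unfolding leading_part_def lookup_sum
    by (intro sum.cong) (auto simp: lookup_single when_def)
  then show ?thesis by (auto simp: in_keys_iff)
qed

lemma leading_part_zero [simp]: "leading_part lt 0 = 0"
  by (simp add: leading_part_def)

text \<open>Recognises a leading part: \<open>r\<close> lies strictly below the
  \<open>lt\<close>-class containing \<open>h\<close>, so it cancels nothing in \<open>h\<close>,
  and the key \<open>m\<close> of \<open>h\<close> dominates every key of \<open>r\<close>.\<close>

lemma leading_part_eqI:
  assumes lt: "monomial_preorder lt" and m: "m \<in> Poly_Mapping.keys h"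
    and h: "\<And>a. a \<in> Poly_Mapping.keys h \<Longrightarrow> incomparable lt a m"
    and r: "\<And>a. a \<in> Poly_Mapping.keys r \<Longrightarrow> lt a m"
  shows "leading_part lt (h + r) = h"
proof (rule poly_mapping_eqI)
  fix a
  have rh: "Poly_Mapping.lookup r x = 0" if "x \<in> Poly_Mapping.keys h" for x
    using h[OF that] r[of x] by (auto simp: incomparable_def in_keys_iff)
  have mk: "m \<in> Poly_Mapping.keys (h + r)"
    using m rh[OF m] by (simp add: in_keys_iff lookup_add)
  have ub: "lt b m \<or> incomparable lt b m" if "b \<in> Poly_Mapping.keys (h + r)" for b
    using that h r keys_add[of h r] by blast
  show "Poly_Mapping.lookup (leading_part lt (h + r)) a = Poly_Mapping.lookup h a"
  proof (cases "a \<in> Poly_Mapping.keys h")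
    case True
    then have "\<not> lt a b" if "b \<in> Poly_Mapping.keys (h + r)" for b
      using ub[OF that] h[OF True] by (meson incomparable_def incomparable_sym
          less_incomparable_trans[OF lt] monomial_preorder_trans[OF lt])
    then show ?thesis
      using rh[OF True] by (simp add: lookup_leading_part lookup_add)
  next
    case False
    then show ?thesis
      using r[of a] mk by (fastforce simp: lookup_leading_part lookup_add in_keys_iff)
  qed
qed

lemma ex_maximal_key:
  assumes lt: "monomial_preorder lt" and "f \<noteq> 0"
  obtains m where "m \<in> Poly_Mapping.keys f" "\<And>a. a \<in> Poly_Mapping.keys f \<Longrightarrow> \<not> lt m a"
proof -
  have "asymp_on (Poly_Mapping.keys f) lt" "transp_on (Poly_Mapping.keys f) lt"
    using monomial_preorder_irrefl[OF lt] monomial_preorder_trans[OF lt]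
    by (blast intro: asymp_onI transp_onI)+
  then obtain m where "m \<in> Poly_Mapping.keys f" "\<forall>a\<in>Poly_Mapping.keys f. a \<noteq> m \<longrightarrow> \<not> lt m a"
    using Finite_Set.bex_max_element[of "Poly_Mapping.keys f" lt] assms(2) by auto
  then show ?thesis
    using monomial_preorder_irrefl[OF lt] by (intro that[of m]) auto
qed

text \<open>Every key of \<open>f\<close> is below the maximal key \<open>m\<close> or incomparable
  to it, so the maximal keys are exactly those in the class of \<open>m\<close>. This is the
  counterpart of \<open>leading_part_eqI\<close>.\<close>

lemma leading_part_decomp:
  assumes lt: "monomial_preorder lt"
    and m: "m \<in> Poly_Mapping.keys f" "\<And>a. a \<in> Poly_Mapping.keys f \<Longrightarrow> \<not> lt m a"
  obtains r where "f = leading_part lt f + r" "m \<in> Poly_Mapping.keys (leading_part lt f)"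
    "\<And>a. a \<in> Poly_Mapping.keys (leading_part lt f) \<Longrightarrow> incomparable lt a m"
    "\<And>a. a \<in> Poly_Mapping.keys r \<Longrightarrow> lt a m"
proof (rule that[of "f - leading_part lt f"])
  show "m \<in> Poly_Mapping.keys (leading_part lt f)"
    using m by (auto simp: in_keys_iff lookup_leading_part)
  show "incomparable lt a m" if "a \<in> Poly_Mapping.keys (leading_part lt f)" for a
    using that m by (auto simp: in_keys_iff lookup_leading_part incomparable_def split: if_splits)
  show "lt a m" if a: "a \<in> Poly_Mapping.keys (f - leading_part lt f)" for a
  proof -
    obtain b where "b \<in> Poly_Mapping.keys f" "lt a b"
      using a by (auto simp: in_keys_iff lookup_minus lookup_leading_part split: if_splits)
    then show ?thesis
      by (metis m(2) incomparable_def less_incomparable_trans[OF lt] monomial_preorder_trans[OF lt])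
  qed
qed simp

section \<open>The multiplicative set of denominators\<close>

text \<open>Reduces the leading part condition to comparisons with \<open>1\<close>, which lets the
  units of different preorders be compared.\<close>

lemma unit_leading_iff:
  assumes lt: "monomial_preorder lt"
  shows "u \<in> unit_leading lt \<longleftrightarrow>
    Poly_Mapping.lookup u 0 = 1 \<and> (\<forall>a\<in>Poly_Mapping.keys u. a \<noteq> 0 \<longrightarrow> lt a 0)"
proof
  assume "u \<in> unit_leading lt"
  then have u: "leading_part lt u = 1" by (simp add: unit_leading_def)
  then have "u \<noteq> 0" by auto
  then obtain m where m: "m \<in> Poly_Mapping.keys u" "\<And>a. a \<in> Poly_Mapping.keys u \<Longrightarrow> \<not> lt m a"
    using ex_maximal_key[OF lt] by blast
  obtain r where r: "u = 1 + r" "m \<in> Poly_Mapping.keys (1 :: _ \<Rightarrow>\<^sub>0 'b)"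
    "\<And>a. a \<in> Poly_Mapping.keys r \<Longrightarrow> lt a m"
    using leading_part_decomp[OF lt m] unfolding u by blast
  then have [simp]: "m = 0" by simp
  have "Poly_Mapping.lookup r 0 = 0"
    using r(3)[of 0] monomial_preorder_irrefl[OF lt] by (auto simp: in_keys_iff)
  then show "Poly_Mapping.lookup u 0 = 1 \<and> (\<forall>a\<in>Poly_Mapping.keys u. a \<noteq> 0 \<longrightarrow> lt a 0)"
    using r(3) by (auto simp: r(1) lookup_add in_keys_iff lookup_one)
next
  assume u: "Poly_Mapping.lookup u 0 = 1 \<and> (\<forall>a\<in>Poly_Mapping.keys u. a \<noteq> 0 \<longrightarrow> lt a 0)"
  have "leading_part lt (1 + (u - 1)) = 1"
  proof (rule leading_part_eqI[OF lt])
    show "lt a 0" if "a \<in> Poly_Mapping.keys (u - 1)" for a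
      using that u by (cases "a = 0") (auto simp: in_keys_iff lookup_minus lookup_one)
  qed (use monomial_preorder_irrefl[OF lt] in \<open>auto simp: incomparable_def\<close>)
  then show "u \<in> unit_leading lt" by (simp add: unit_leading_def)
qed

lemma unit_leading_nonzero: "u \<in> unit_leading lt \<Longrightarrow> u \<noteq> 0"
  by (auto simp: unit_leading_def)

lemma one_in_unit_leading: "monomial_preorder lt \<Longrightarrow> 1 \<in> unit_leading lt"
  by (simp add: unit_leading_iff)

text \<open>A monomial tied with \<open>1\<close> under \<open>lt\<close> is never below
  \<open>1\<close> for the global \<open>lt'\<close>, so the product order puts no further monomials
  below \<open>1\<close>.\<close>

lemma unit_leading_product:
  assumes "monomial_preorder lt" "monomial_order lt'" "global_preorder lt'"
  shows "unit_leading (product_preorder lt lt') = unit_leading lt"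
  using assms global_monomial_order_nonneg[OF assms(2,3)]
  by (auto simp: unit_leading_iff monomial_preorder_product product_preorder_def)

text \<open>In \<open>u * f = f + (u - 1) * f\<close> every monomial of \<open>u - 1\<close> is
  below \<open>1\<close>, so the second summand stays strictly below the leading class of
  \<open>f\<close>.\<close>

lemma leading_part_unit_mult:
  assumes lt: "monomial_preorder lt" and u: "u \<in> unit_leading lt"
  shows "leading_part lt (u * f) = leading_part lt f"
proof (cases "f = 0")
  case False
  then obtain m where m: "m \<in> Poly_Mapping.keys f" "\<And>a. a \<in> Poly_Mapping.keys f \<Longrightarrow> \<not> lt m a"
    using ex_maximal_key[OF lt] by blast
  define h where "h = leading_part lt f"
  obtain r where r: "f = h + r" "m \<in> Poly_Mapping.keys h" "\<And>a. a \<in> Poly_Mapping.keys h \<Longrightarrow> incomparable lt a m"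
    "\<And>a. a \<in> Poly_Mapping.keys r \<Longrightarrow> lt a m"
    using leading_part_decomp[OF lt m] unfolding h_def by blast
  have w: "lt a 0" if "a \<in> Poly_Mapping.keys (u - 1)" for a
    using that u unfolding unit_leading_iff[OF lt]
    by (cases "a = 0") (auto simp: in_keys_iff lookup_minus lookup_one)
  have "leading_part lt (h + (r + (u - 1) * f)) = h"
  proof (rule leading_part_eqI[OF lt r(2,3)])
    fix a assume "a \<in> Poly_Mapping.keys (r + (u - 1) * f)"
    then consider "a \<in> Poly_Mapping.keys r" | "a \<in> Poly_Mapping.keys ((u - 1) * f)"
      using keys_add[of r "(u - 1) * f"] by blast
    then show "lt a m"
    proof cases
      case 2
      then obtain b c where a: "a = b + c" and b: "b \<in> Poly_Mapping.keys (u - 1)"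
        and c: "c \<in> Poly_Mapping.keys f"
        using keys_mult[of "u - 1" f] by blast
      have "lt (b + c) c"
        using w[OF b] monomial_preorder_add_iff[OF lt, of b c 0] by simp
      moreover have "lt c m \<or> incomparable lt c m"
        using c m(2) by (auto simp: incomparable_def)
      ultimately show ?thesis
        using a less_incomparable_trans[OF lt] monomial_preorder_trans[OF lt] by blast
    qed (rule r(4))
  qed
  moreover have "u * f = h + (r + (u - 1) * f)"
    using r(1) by (simp add: left_diff_distrib)
  ultimately show ?thesis by (simp only: h_def)
qed simp

section \<open>Leading parts in the localization\<close>

text \<open>The chosen numerator depends on the preorder only through its set of units. Hence one
  polynomial \<open>g\<close> computes the leading part of \<open>f\<close> both for
  \<open>lt\<close> and for its product with a global order.\<close>

lemma loc_leading_partE: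
  fixes f :: "('n::{finite,linorder}, 'k::field) mpoly fract"
  assumes f: "f \<in> localization lt"
  obtains g u where "u \<in> unit_leading lt" "Fract u 1 * f = Fract g 1"
    "\<And>lt2. (unit_leading lt2 :: ('n, 'k) mpoly set) = unit_leading lt \<Longrightarrow>
      loc_leading_part lt2 f = leading_part lt2 g"
proof -
  define g where "g = (SOME g. \<exists>u \<in> unit_leading lt. Fract u 1 * f = Fract g 1)"
  obtain p v where "f = Fract p v" and v: "v \<in> unit_leading lt"
    using f by (auto simp: localization_def)
  then have "Fract v 1 * f = Fract p 1"
    using unit_leading_nonzero[OF v] by (simp add: eq_fract)
  then have "\<exists>u \<in> unit_leading lt. Fract u 1 * f = Fract g 1"
    unfolding g_def using v
    by (intro someI[of "\<lambda>g. \<exists>u \<in> unit_leading lt. Fract u 1 * f = Fract g 1"]) auto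
  then obtain u where u: "u \<in> unit_leading lt" "Fract u 1 * f = Fract g 1" by blast
  show ?thesis
    by (rule that[OF u]) (simp add: loc_leading_part_def g_def)
qed

lemma Fract_in_localization: "monomial_preorder lt \<Longrightarrow> Fract p 1 \<in> localization lt"
  unfolding localization_def using one_in_unit_leading by blast

text \<open>The numerator chosen for a polynomial \<open>p\<close> is \<open>u * p\<close> with
  \<open>u\<close> a unit, and units do not change leading parts.\<close>

lemma loc_leading_part_Fract:
  assumes lt: "monomial_preorder lt"
  shows "loc_leading_part lt (Fract p 1) = leading_part lt p"
proof -
  obtain g u where u: "u \<in> unit_leading lt" "Fract u 1 * Fract p 1 = Fract g 1"
    "loc_leading_part lt (Fract p 1) = leading_part lt g"
    using loc_leading_partE[OF Fract_in_localization[OF lt]] by metis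
  then have "u * p = g" by (simp add: eq_fract)
  then show ?thesis using u leading_part_unit_mult[OF lt] by metis
qed

section \<open>Generated ideals in rings given by type classes\<close>

lemma ring_of_type_algebra_sel [simp]:
  "carrier ring_of_type_algebra = UNIV"
  "x \<otimes>\<^bsub>ring_of_type_algebra\<^esub> y = x * y"
  "x \<oplus>\<^bsub>ring_of_type_algebra\<^esub> y = x + y"
  "\<zero>\<^bsub>ring_of_type_algebra\<^esub> = 0"
  "\<one>\<^bsub>ring_of_type_algebra\<^esub> = 1"
  by (simp_all add: ring_of_type_algebra_def)

lemma ideal_ring_of_type_algebraI:
  fixes J :: "'a::comm_ring_1 set"
  assumes "0 \<in> J" "\<And>x y. x \<in> J \<Longrightarrow> y \<in> J \<Longrightarrow> x + y \<in> J" "\<And>a x. x \<in> J \<Longrightarrow> a * x \<in> J"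
  shows "ideal J ring_of_type_algebra"
proof -
  interpret R: ring "ring_of_type_algebra :: 'a ring" by (rule ring_from_type_algebra)
  have "\<ominus>\<^bsub>ring_of_type_algebra\<^esub> x = - x" for x :: 'a
    using R.minus_equality[of "- x" x] by simp
  then have "- x \<in> J \<Longrightarrow> \<ominus>\<^bsub>ring_of_type_algebra\<^esub> x \<in> J" for x by simp
  \<comment> \<open>Closure under additive inverses is multiplication by \<open>-1\<close>.\<close>
  then show ?thesis
    using assms assms(3)[of _ "-1"]
    by (intro idealI R.ring_axioms group.subgroupI R.a_group)
      (auto simp: a_inv_def mult.commute)
qed

lemma zero_in_genideal:
  fixes S :: "'a::comm_ring_1 set"
  shows "0 \<in> genideal ring_of_type_algebra S"
proof -
  interpret ideal "genideal ring_of_type_algebra S" ring_of_type_algebra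
    by (rule ring.genideal_ideal[OF ring_from_type_algebra]) simp
  show ?thesis using additive_subgroup.zero_closed[OF additive_subgroup_axioms] by simp
qed

lemma mult_in_genideal:
  fixes S :: "'a::comm_ring_1 set"
  assumes "x \<in> genideal ring_of_type_algebra S"
  shows "a * x \<in> genideal ring_of_type_algebra S"
  using assms ideal.I_l_closed[OF ring.genideal_ideal[OF ring_from_type_algebra]] by fastforce

lemma add_in_genideal:
  fixes S :: "'a::comm_ring_1 set"
  assumes "x \<in> genideal ring_of_type_algebra S" "y \<in> genideal ring_of_type_algebra S"
  shows "x + y \<in> genideal ring_of_type_algebra S"
proof -
  interpret ideal "genideal ring_of_type_algebra S" ring_of_type_algebra
    by (rule ring.genideal_ideal[OF ring_from_type_algebra]) simp
  show ?thesis using additive_subgroup.a_closed[OF additive_subgroup_axioms assms] by simp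
qed

lemma subset_genideal: "S \<subseteq> genideal ring_of_type_algebra S"
  by (auto simp: genideal_def)

lemma genideal_mono: "S \<subseteq> T \<Longrightarrow> genideal R S \<subseteq> genideal R T"
  by (auto simp: genideal_def)

text \<open>Polynomials all of whose monomials are divisible by monomials occurring in
  \<open>S\<close> form an ideal containing \<open>S\<close>. This turns membership in a leading
  ideal into divisibility of monomials.\<close>

lemma keys_in_genideal:
  fixes S :: "('n, 'k::field) mpoly set"
  assumes f: "f \<in> genideal ring_of_type_algebra S" and a: "a \<in> Poly_Mapping.keys f"
  shows "\<exists>s\<in>S. \<exists>b\<in>Poly_Mapping.keys s. \<exists>c. a = b + c"
proof -
  define J :: "('n, 'k) mpoly set"
    where "J = {f. \<forall>a\<in>Poly_Mapping.keys f. \<exists>s\<in>S. \<exists>b\<in>Poly_Mapping.keys s. \<exists>c. a = b + c}"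
  have "ideal J ring_of_type_algebra"
  proof (rule ideal_ring_of_type_algebraI)
    show "x + y \<in> J" if "x \<in> J" "y \<in> J" for x y
      using that keys_add[of x y] unfolding J_def by blast
    show "p * x \<in> J" if x: "x \<in> J" for p x
      unfolding J_def
    proof (intro CollectI ballI)
      fix a assume "a \<in> Poly_Mapping.keys (p * x)"
      then obtain d e where a: "a = d + e" and e: "e \<in> Poly_Mapping.keys x"
        using keys_mult[of p x] by blast
      obtain s b c where s: "s \<in> S" "b \<in> Poly_Mapping.keys s" "e = b + c"
        using x e unfolding J_def by blast
      then have "a = b + (d + c)" by (simp add: a ac_simps)
      with s show "\<exists>s\<in>S. \<exists>b\<in>Poly_Mapping.keys s. \<exists>c. a = b + c" by blast
    qed
  qed (simp add: J_def)
  moreover have "S \<subseteq> J"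
    unfolding J_def by (force intro: exI[of _ 0])
  ultimately have "f \<in> J"
    using f by (auto simp: genideal_def)
  then show ?thesis using a by (auto simp: J_def)
qed

section \<open>Division with respect to the product order\<close>

text \<open>Totality of the product order makes \<open>m\<close> the only maximal key.\<close>

lemma product_leading_part_eq_single:
  assumes lt: "monomial_preorder lt" and lt': "monomial_order lt'"
    and m: "m \<in> Poly_Mapping.keys f"
      "\<And>a. a \<in> Poly_Mapping.keys f \<Longrightarrow> \<not> product_preorder lt lt' m a"
  shows "leading_part (product_preorder lt lt') f = Poly_Mapping.single m (Poly_Mapping.lookup f m)"
proof (rule poly_mapping_eqI)
  fix a
  have "product_preorder lt lt' a m" if "a \<in> Poly_Mapping.keys f" "a \<noteq> m" for a
    using product_incomparable_iff[OF lt lt', of a m] that m by (auto simp: incomparable_def)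
  then show "Poly_Mapping.lookup (leading_part (product_preorder lt lt') f) a =
      Poly_Mapping.lookup (Poly_Mapping.single m (Poly_Mapping.lookup f m)) a"
    using m by (fastforce simp: lookup_leading_part lookup_single when_def in_keys_iff)
qed

lemma lookup_single_mult:
  fixes f :: "('n, 'k::field) mpoly"
  shows "Poly_Mapping.lookup (Poly_Mapping.single d c * f) (d + b) = c * Poly_Mapping.lookup f b"
proof -
  \<comment> \<open>The product formula sums over all exponents \<open>l\<close>; at most
    \<open>l = d\<close> contributes.\<close>
  have "(\<Sum>l\<in>{d}. Poly_Mapping.lookup (Poly_Mapping.single d c) l *
      (\<Sum>q. Poly_Mapping.lookup f q when d + b = l + q)) =
    (\<Sum>l. Poly_Mapping.lookup (Poly_Mapping.single d c) l *
      (\<Sum>q. Poly_Mapping.lookup f q when d + b = l + q))"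
    by (rule Sum_any.expand_superset[symmetric]) (auto simp: lookup_single when_def)
  then show ?thesis
    by (simp add: lookup_mult eq_commute[of b])
qed

lemma ideal_localization_mult:
  assumes lt: "monomial_preorder lt" and I: "ideal I (localization_ring lt)" and f: "f \<in> I"
  shows "Fract t 1 * f \<in> I"
  using ideal.I_l_closed[OF I f, of "Fract t 1"] Fract_in_localization[OF lt, of t]
  by (simp add: localization_ring_def ring_of_type_algebra_def)

text \<open>The division argument, stated for polynomials in \<open>I\<close>; every element of
  \<open>I\<close> takes this form after multiplication by a unit.\<close>

lemma leading_part_in_leading_ideal:
  fixes lt lt' :: "'n::{finite,linorder} monomial \<Rightarrow> 'n monomial \<Rightarrow> bool"
    and I G :: "('n, 'k::field) mpoly fract set"
  assumes lt: "monomial_preorder lt" and lt': "monomial_order lt'" and gl: "global_preorder lt'"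
    and I: "ideal I (localization_ring lt)"
    and G: "G \<subseteq> I"
      "leading_ideal (product_preorder lt lt') I \<subseteq> leading_ideal (product_preorder lt lt') G"
    and p: "Fract p 1 \<in> I"
  shows "leading_part lt p \<in> leading_ideal lt G"
proof -
  let ?P = "product_preorder lt lt'"
  have P: "monomial_preorder ?P" by (rule monomial_preorder_product[OF lt lt'])
  interpret I: ideal I "localization_ring lt" by (rule I)
  have I_sub: "I \<subseteq> localization lt"
    using I.a_subset by (simp add: localization_ring_def)
  note I_mult = ideal_localization_mult[OF lt I]
  have I_add: "f + g \<in> I" if "f \<in> I" "g \<in> I" for f g
    using additive_subgroup.a_closed[OF I.additive_subgroup_axioms that]
    by (simp add: localization_ring_def ring_of_type_algebra_def)
  \<comment> \<open>Induction along \<open>lt'\<close> on the \<open>?P\<close>-leading monomial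
    \<open>m\<close>; \<open>p\<close> is quantified inside because the induction hypothesis is
    applied to another polynomial.\<close>
  have step: "\<forall>p. Fract p 1 \<in> I \<longrightarrow> m \<in> Poly_Mapping.keys p \<longrightarrow>
      (\<forall>a\<in>Poly_Mapping.keys p. \<not> ?P m a) \<longrightarrow> leading_part lt p \<in> leading_ideal lt G" for m
    using global_monomial_order_wfp[OF lt' gl]
  proof (induction m rule: wfp_induct_rule)
    case (less m)
    show ?case
    proof (intro allI impI)
      fix p
      assume p: "Fract p 1 \<in> I" and m: "m \<in> Poly_Mapping.keys p"
        and "\<forall>a\<in>Poly_Mapping.keys p. \<not> ?P m a"
      then have mP: "\<And>a. a \<in> Poly_Mapping.keys p \<Longrightarrow> \<not> ?P m a" by blast
      have "loc_leading_part ?P (Fract p 1) = Poly_Mapping.single m (Poly_Mapping.lookup p m)"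
        using loc_leading_part_Fract[OF P, of p] product_leading_part_eq_single[OF lt lt' m mP]
        by simp
      then have "Poly_Mapping.single m (Poly_Mapping.lookup p m) \<in> leading_ideal ?P I"
        unfolding leading_ideal_def using p subset_genideal by (metis imageI subsetD)
      then obtain g b d where g: "g \<in> G" and b: "b \<in> Poly_Mapping.keys (loc_leading_part ?P g)"
        and m_eq: "m = d + b"
        using G(2) keys_in_genideal[of "Poly_Mapping.single m (Poly_Mapping.lookup p m)" _ m] m
        unfolding leading_ideal_def by (fastforce simp: in_keys_iff add.commute)
      \<comment> \<open>The two orders have the same units, so the same numerator \<open>q\<close>
        of \<open>g\<close> gives both leading parts.\<close>
      obtain q u where u: "Fract u 1 * g = Fract q 1"
        and q: "loc_leading_part lt g = leading_part lt q"
          "loc_leading_part ?P g = leading_part ?P q"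
        using loc_leading_partE[of g lt] g G(1) I_sub unit_leading_product[OF lt lt' gl]
        by (metis subsetD)
      have qI: "Fract q 1 \<in> I"
        using I_mult[of g u] g G(1) u by auto
      have bP: "\<not> ?P b a" if "a \<in> Poly_Mapping.keys q" for a
        using b that by (auto simp: q in_keys_iff lookup_leading_part split: if_splits)
      have bq: "b \<in> Poly_Mapping.keys q"
        using b by (auto simp: q in_keys_iff lookup_leading_part split: if_splits)
      \<comment> \<open>As \<open>?P\<close> extends \<open>lt\<close>, keys maximal for
        \<open>?P\<close> are maximal for \<open>lt\<close>, so both polynomials split at
        \<open>m\<close> and \<open>b\<close>.\<close>
      have lt_P: "lt x y \<Longrightarrow> ?P x y" for x y by (simp add: product_preorder_def)
      have m_max: "\<not> lt m a" if "a \<in> Poly_Mapping.keys p" for a using mP[OF that] lt_P by blast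
      have b_max: "\<not> lt b a" if "a \<in> Poly_Mapping.keys q" for a using bP[OF that] lt_P by blast
      obtain r where r: "p = leading_part lt p + r"
          "\<And>a. a \<in> Poly_Mapping.keys (leading_part lt p) \<Longrightarrow> incomparable lt a m"
          "\<And>a. a \<in> Poly_Mapping.keys r \<Longrightarrow> lt a m"
        by (rule leading_part_decomp[OF lt m m_max]) (assumption, rule that)
      obtain r' where r': "q = leading_part lt q + r'"
          "\<And>a. a \<in> Poly_Mapping.keys (leading_part lt q) \<Longrightarrow> incomparable lt a b"
          "\<And>a. a \<in> Poly_Mapping.keys r' \<Longrightarrow> lt a b"
        by (rule leading_part_decomp[OF lt bq b_max]) (assumption, rule that)
      \<comment> \<open>The quotient of the leading terms: \<open>t * q\<close> agrees with
        \<open>p\<close> at the exponent \<open>m = d + b\<close>.\<close>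
      define t where
        "t = Poly_Mapping.single d (Poly_Mapping.lookup p m / Poly_Mapping.lookup q b)"
      have keys_t: "\<exists>a'\<in>Poly_Mapping.keys f. a = d + a'" if "a \<in> Poly_Mapping.keys (t * f)" for f a
        using that keys_mult[of t f] by (auto simp: t_def split: if_splits)
      define p' where "p' = p - t * q"
      \<comment> \<open>What survives of the leading parts; it lies in the \<open>lt\<close>-class
        of \<open>m\<close>, while the difference of the remainders lies below that class.\<close>
      define h where "h = leading_part lt p - t * leading_part lt q"
      have p'_eq: "p' = h + (r - t * r')"
        unfolding p'_def h_def by (subst r(1), subst r'(1)) (simp add: algebra_simps)
      have keys_h: "incomparable lt a m" if "a \<in> Poly_Mapping.keys h" for a
        using that keys_diff[of "leading_part lt p" "t * leading_part lt q"] r(2) r'(2)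
          keys_t incomparable_add_iff_left[OF lt] unfolding h_def m_eq by blast
      have keys_r: "lt a m" if "a \<in> Poly_Mapping.keys (r - t * r')" for a
        using that keys_diff[of r "t * r'"] r(3) r'(3)
          keys_t monomial_preorder_add_iff_left[OF lt] unfolding m_eq by blast
      have p'_I: "Fract p' 1 \<in> I"
      proof -
        have "Fract p' 1 = Fract p 1 + Fract (- t) 1 * Fract q 1"
          by (simp add: p'_def)
        then show ?thesis using I_add[OF p I_mult[OF qI]] by (simp only:)
      qed
      have "h \<in> leading_ideal lt G"
      proof (cases "h = 0")
        case True
        then show ?thesis by (simp add: leading_ideal_def zero_in_genideal)
      next
        case False
        then obtain a where a: "a \<in> Poly_Mapping.keys h" by (metis all_not_in_conv keys_eq_empty)
        have "\<not> lt a m" "\<not> lt m a" using keys_h[OF a] by (auto simp: incomparable_def)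
        \<comment> \<open>A key of \<open>h\<close> is incomparable to \<open>m\<close>, so it
          cannot occur in the remainder and does not cancel in \<open>p'\<close>.\<close>
        then have "Poly_Mapping.lookup (r - t * r') a = 0"
          using keys_r[of a] by (metis in_keys_iff)
        then have ap': "a \<in> Poly_Mapping.keys p'"
          using a by (simp only: p'_eq lookup_add in_keys_iff add_0_right not_False_eq_True)
        then have "p' \<noteq> 0" by (metis empty_iff keys_zero)
        then obtain m' where m': "m' \<in> Poly_Mapping.keys p'"
          "\<And>a. a \<in> Poly_Mapping.keys p' \<Longrightarrow> \<not> ?P m' a"
          using ex_maximal_key[OF P] by blast
        have "Poly_Mapping.lookup p' m = 0"
          using bq by (simp add: p'_def t_def m_eq lookup_minus lookup_single_mult in_keys_iff)
        then have "m' \<noteq> m" using m'(1) by (auto simp: in_keys_iff)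
        \<comment> \<open>All keys of \<open>p\<close> and of \<open>t * q\<close> are at most
          \<open>m\<close> for \<open>?P\<close>, hence so are those of \<open>p'\<close>.\<close>
        moreover have "\<not> ?P m m'"
          using m'(1) keys_diff[of p "t * q"] mP bP keys_t monomial_preorder_add_iff_left[OF P]
          unfolding p'_def m_eq by blast
        \<comment> \<open>The leading monomial of \<open>p'\<close> cannot drop below the class of
          \<open>m\<close>, since the key \<open>a\<close> of that class survives in
          \<open>p'\<close>.\<close>
        moreover have "\<not> lt m' m"
        proof
          assume "lt m' m"
          then have "lt m' a"
            by (rule less_incomparable_trans[OF lt _ incomparable_sym[OF keys_h[OF a]]])
          with m'(2)[OF ap'] lt_P show False by blast
        qed
        \<comment> \<open>By totality \<open>m'\<close> is strictly below \<open>m\<close> for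
          \<open>?P\<close>; since \<open>lt\<close> does not decide this, the descent happens in
          \<open>lt'\<close>.\<close>
        ultimately have m'm: "incomparable lt m' m" "lt' m' m"
          using product_incomparable_iff[OF lt lt', of m' m]
          by (auto simp: incomparable_def product_preorder_def)
        have m'h: "m' \<in> Poly_Mapping.keys h"
        proof -
          have "m' \<notin> Poly_Mapping.keys (r - t * r')"
            using keys_r[of m'] m'm(1) unfolding incomparable_def by blast
          then show ?thesis
            using m'(1) keys_add[of h "r - t * r'"] unfolding p'_eq by blast
        qed
        have "leading_part lt p' = h"
          unfolding p'_eq
        proof (rule leading_part_eqI[OF lt m'h])
          show "incomparable lt a m'" if "a \<in> Poly_Mapping.keys h" for a
            by (rule incomparable_trans[OF lt keys_h[OF that] incomparable_sym[OF m'm(1)]])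
          show "lt a m'" if "a \<in> Poly_Mapping.keys (r - t * r')" for a
            by (rule less_incomparable_trans[OF lt keys_r[OF that] incomparable_sym[OF m'm(1)]])
        qed
        then show ?thesis
          using less.IH[OF m'm(2)] p'_I m' by auto
      qed
      \<comment> \<open>The leading part of \<open>q\<close> is the generator contributed by
        \<open>g\<close>.\<close>
      moreover have "t * leading_part lt q \<in> leading_ideal lt G"
        unfolding leading_ideal_def using g
        by (intro mult_in_genideal subsetD[OF subset_genideal]) (auto simp flip: q(1))
      ultimately have "h + t * leading_part lt q \<in> leading_ideal lt G"
        unfolding leading_ideal_def by (rule add_in_genideal)
      then show "leading_part lt p \<in> leading_ideal lt G" by (simp add: h_def)
    qed
  qed
  show ?thesis
  proof (cases "p = 0")
    case True
    then show ?thesis by (simp add: leading_ideal_def zero_in_genideal)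
  next
    case False
    then obtain m where "m \<in> Poly_Mapping.keys p" "\<And>a. a \<in> Poly_Mapping.keys p \<Longrightarrow> \<not> ?P m a"
      using ex_maximal_key[OF P] by blast
    then show ?thesis using step p by blast
  qed
qed

theorem theorem2p6:
  fixes lt lt' :: "'n::{finite,linorder} monomial \<Rightarrow> 'n monomial \<Rightarrow> bool"
    and I :: "('n, 'k::field) mpoly fract set"
  assumes "monomial_preorder lt"
    and "monomial_order lt'" and "global_preorder lt'"
    and "ideal I (localization_ring lt)"
  shows "(localization (product_preorder lt lt') :: ('n, 'k) mpoly fract set) = localization lt \<and>
    (\<forall>G. standard_basis (product_preorder lt lt') I G \<longrightarrow> standard_basis lt I G)"
proof (intro conjI allI impI)
  show "(localization (product_preorder lt lt') :: ('n, 'k) mpoly fract set) = localization lt"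
    by (simp add: localization_def unit_leading_product[OF assms(1-3)])
next
  fix G
  assume "standard_basis (product_preorder lt lt') I G"
  then have G: "finite G" "G \<subseteq> I"
    "leading_ideal (product_preorder lt lt') I \<subseteq> leading_ideal (product_preorder lt lt') G"
    by (auto simp: standard_basis_def)
  interpret I: ideal I "localization_ring lt" by (rule assms(4))
  have "loc_leading_part lt f \<in> leading_ideal lt G" if f: "f \<in> I" for f
  proof -
    have "f \<in> localization lt"
      using I.a_subset f by (auto simp: localization_ring_def)
    \<comment> \<open>Clearing the denominator of \<open>f\<close> by a unit yields a polynomial
      that stays in \<open>I\<close> and carries the leading part of \<open>f\<close>.\<close>
    then obtain p u where p: "Fract u 1 * f = Fract p 1"
      "loc_leading_part lt f = leading_part lt p"
      using loc_leading_partE by metis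
    moreover have "Fract u 1 * f \<in> I"
      by (rule ideal_localization_mult[OF assms(1,4) f])
    ultimately show ?thesis
      using leading_part_in_leading_ideal[OF assms G(2,3)] by metis
  qed
  then have "leading_ideal lt I \<subseteq> leading_ideal lt G"
    unfolding leading_ideal_def
    by (intro ring.genideal_minimal[OF ring_from_type_algebra]
        ring.genideal_ideal[OF ring_from_type_algebra]) auto
  moreover have "leading_ideal lt G \<subseteq> leading_ideal lt I"
    unfolding leading_ideal_def by (intro genideal_mono image_mono G(2))
  ultimately show "standard_basis lt I G"
    using G by (auto simp: standard_basis_def)
qed

end
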